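(* Let $\mathcal F$ be a function ring over a field $K$ and let $F$ be a set of polynomials in $\mathcal F\setminus\{o\}$. Then $F$ is a right Gröbner basis if and only if (1) for all $f\in F$ and all monomials $m\in M(\mathcal F)$ we have $f\star m\stackrel{*}{\longrightarrow}{}^{r}_{F}\,o$, and (2) for all $p,q\in F$ (not necessarily different) and every tuple $(t,u_1,u_2)\in\mathcal C_s(p,q)$ we have $\mathrm{spol}_r(p,q,t,u_1,u_2)\stackrel{*}{\longrightarrow}{}^{r}_{F}\,o$.
   Context: Function ring: $T$ is a set, $K$ a field, and $\mathcal F$ is the set of functions $f:T\to K$ with finite support $\mathrm{supp}(f)$; $\mathcal F$ has pointwise addition, zero function $o$, scalar multiplication $(\alpha\cdot f)(t)=(f\cdot\alpha)(t)=\alpha f(t)$, and a multiplication $\star:\mathcal F\times\mathcal F\to\mathcal F$ making it an associative ring (not necessarily with unit) such that $(\alpha\cdot f)\star g=\alpha\cdot(f\star g)$ and $f\star(g\cdot\alpha)=(f\star g)\cdot\alpha$. Elements of $\mathcal F$ are called polynomials. $M(\mathcal F)$ is the set of monomials (functions with one-element support); monomials with coefficient $1$ are identified with elements of $T$ (terms). $\mathrm{ideal}_r(F)=\{\sum_{i=1}^n f_i\star g_i\mid f_i\in F,\ g_i\in\mathcal F,\ n\in\mathbb N\}$. $\succeq$ is a fixed total well-founded ordering on $T$. For $f\ne o$, $\operatorname{HT}(f)$ is the $\succeq$-largest element of $\mathrm{supp}(f)$, $\operatorname{HC}(f)=f(\operatorname{HT}(f))$ and $\operatorname{HM}(f)=\operatorname{HC}(f)\cdot\operatorname{HT}(f)$.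 For $t\in T$, $g\in\mathcal F$, "$t\succ g$" means $g=o$ or $t\succ\operatorname{HT}(g)$. An equality $\operatorname{HT}(h)=t$ presupposes $h\ne o$. $\geq$ is a fixed right reductive restriction of $\succeq$: a partial ordering on $T$ such that $t\ge s$ implies $t\succeq s$, and such that for $t,t_1,t_2,w\in T$: if $t_2\ge t_1$, $t_1\succ t$ and $t_2=\operatorname{HT}(t_1\star w)$, then $t_2\succ t\star w$. Right reduction: for non-zero $f,p$, $p\longrightarrow^r_f q$ (at a monomial $\alpha\cdot t$) if there is $m\in M(\mathcal F)$ with $t\in\mathrm{supp}(p)$, $p(t)=\alpha$, $\operatorname{HT}(f\star m)=\operatorname{HT}(\operatorname{HT}(f)\star m)=t\ge\operatorname{HT}(f)$, $\operatorname{HM}(f\star m)=\alpha\cdot t$ and $q=p-f\star m$. $\longrightarrow^r_F=\bigcup_{f\in F}\longrightarrow^r_f$; $\stackrel{*}{\longrightarrow}{}^r_F$ and $\stackrel{*}{\longleftrightarrow}{}^r_F$ are its reflexive transitive and reflexive symmetric transitive closures. A set $F$ is a right Gröbner basis (of $\mathfrak i=\mathrm{ideal}_r(F)$) if $\stackrel{*}{\longleftrightarrow}{}^r_F$ equals the congruence $\equiv_{\mathfrak i}$ ($f\equiv_{\mathfrak i}g$ iff $f-g\in\mathfrak i$) and $\longrightarrow^r_F$ is confluent. For non-zero $p,q$: $\mathcal C_s(p,q)$ is the set of $(t,u_1,u_2)\in T^3$ with $\operatorname{HT}(p\star u_1)=\operatorname{HT}(\operatorname{HT}(p)\star u_1)=t=\operatorname{HT}(q\star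 u_2)=\operatorname{HT}(\operatorname{HT}(q)\star u_2)$, $\operatorname{HT}(p)\le t$ and $\operatorname{HT}(q)\le t$; and $\mathrm{spol}_r(p,q,t,u_1,u_2)=\operatorname{HC}(p\star u_1)^{-1}\cdot p\star u_1-\operatorname{HC}(q\star u_2)^{-1}\cdot q\star u_2$. *)

theory Defs
  imports "HOL-Library.Poly_Mapping" "HOL-Library.Confluence"
begin

text \<open>
  The set of terms is the universe of a type \<open>'t\<close>, and its total well-founded ordering
  is the order of the class \<open>wellorder\<close>. Polynomials are finitely supported functions
  \<open>'t \<Rightarrow>\<^sub>0 'k\<close>; their support is \<^const>\<open>Poly_Mapping.keys\<close>. The product is an
  arbitrary operation \<open>star\<close>, unrelated to the convolution product of
  \<^theory>\<open>HOL-Library.Poly_Mapping\<close>.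
\<close>

definition scalar :: "'k::field \<Rightarrow> ('t \<Rightarrow>\<^sub>0 'k) \<Rightarrow> ('t \<Rightarrow>\<^sub>0 'k)" where
  "scalar c f = Poly_Mapping.map ((*) c) f"

lemma lookup_scalar: "Poly_Mapping.lookup (scalar c f) t = c * Poly_Mapping.lookup f t"
  by (simp add: scalar_def Poly_Mapping.map.rep_eq when_def)

text \<open>As \<open>'k\<close> is commutative, left and right scalar multiplication are the same operation.\<close>

locale function_ring =
  fixes star :: "('t \<Rightarrow>\<^sub>0 'k::field) \<Rightarrow> ('t \<Rightarrow>\<^sub>0 'k) \<Rightarrow> ('t \<Rightarrow>\<^sub>0 'k)"  (infixl "\<star>" 70)
  assumes star_assoc: "(f \<star> g) \<star> h = f \<star> (g \<star> h)"
    and star_distrib_right: "(f + g) \<star> h = f \<star> h + g \<star> h"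
    and star_distrib_left: "f \<star> (g + h) = f \<star> g + f \<star> h"
    and scalar_star: "scalar c f \<star> g = scalar c (f \<star> g)"
    and star_scalar: "f \<star> scalar c g = scalar c (f \<star> g)"

definition monomials :: "('t \<Rightarrow>\<^sub>0 'k::field) set" where
  "monomials = {m. card (Poly_Mapping.keys m) = 1}"

abbreviation term_poly :: "'t \<Rightarrow> ('t \<Rightarrow>\<^sub>0 'k::field)" where
  "term_poly t \<equiv> Poly_Mapping.single t 1"

text \<open>The empty sum is admitted, so the ideal generated by the empty set is the zero ideal.\<close>

definition right_ideal ::
  "(('t \<Rightarrow>\<^sub>0 'k::field) \<Rightarrow> ('t \<Rightarrow>\<^sub>0 'k) \<Rightarrow> ('t \<Rightarrow>\<^sub>0 'k)) \<Rightarrow> ('t \<Rightarrow>\<^sub>0 'k) set \<Rightarrow> ('t \<Rightarrow>\<^sub>0 'k) set"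
  where
  "right_ideal star F =
    {h. \<exists>(n::nat) f g. (\<forall>i<n. f i \<in> F) \<and> h = (\<Sum>i<n. star (f i) (g i))}"

text \<open>Head terms, coefficients and monomials are meaningful for non-zero polynomials only.\<close>

definition HT :: "('t::wellorder \<Rightarrow>\<^sub>0 'k::field) \<Rightarrow> 't" where
  "HT f = Max (Poly_Mapping.keys f)"

definition HC :: "('t::wellorder \<Rightarrow>\<^sub>0 'k::field) \<Rightarrow> 'k" where
  "HC f = Poly_Mapping.lookup f (HT f)"

definition HM :: "('t::wellorder \<Rightarrow>\<^sub>0 'k::field) \<Rightarrow> ('t \<Rightarrow>\<^sub>0 'k)" where
  "HM f = scalar (HC f) (term_poly (HT f))"

definition has_HT :: "('t::wellorder \<Rightarrow>\<^sub>0 'k::field) \<Rightarrow> 't \<Rightarrow> bool" where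
  "has_HT f t \<longleftrightarrow> f \<noteq> 0 \<and> HT f = t"

definition term_gt :: "'t::wellorder \<Rightarrow> ('t \<Rightarrow>\<^sub>0 'k::field) \<Rightarrow> bool" where
  "term_gt t g \<longleftrightarrow> g = 0 \<or> HT g < t"

text \<open>\<open>geq t s\<close> is the relation \<open>t \<ge> s\<close> of the reductive restriction.\<close>

locale right_reductive_restriction =
  fixes star :: "('t::wellorder \<Rightarrow>\<^sub>0 'k::field) \<Rightarrow> ('t \<Rightarrow>\<^sub>0 'k) \<Rightarrow> ('t \<Rightarrow>\<^sub>0 'k)"  (infixl "\<star>" 70)
    and geq :: "'t \<Rightarrow> 't \<Rightarrow> bool"
  assumes geq_refl: "reflp geq"
    and geq_antisym: "antisymp geq"
    and geq_trans: "transp geq"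
    and geq_imp_le: "geq t s \<Longrightarrow> s \<le> t"
    and reductive:
      "\<lbrakk>geq t2 t1; t < t1; has_HT (term_poly t1 \<star> term_poly w) t2\<rbrakk>
        \<Longrightarrow> term_gt t2 (term_poly t \<star> term_poly w)"

definition right_red1 ::
  "(('t::wellorder \<Rightarrow>\<^sub>0 'k::field) \<Rightarrow> ('t \<Rightarrow>\<^sub>0 'k) \<Rightarrow> ('t \<Rightarrow>\<^sub>0 'k)) \<Rightarrow> ('t \<Rightarrow> 't \<Rightarrow> bool)
    \<Rightarrow> ('t \<Rightarrow>\<^sub>0 'k) \<Rightarrow> ('t \<Rightarrow>\<^sub>0 'k) \<Rightarrow> ('t \<Rightarrow>\<^sub>0 'k) \<Rightarrow> bool"
  where
  "right_red1 star geq f p q \<longleftrightarrow> f \<noteq> 0 \<and> p \<noteq> 0 \<and>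
    (\<exists>t \<in> Poly_Mapping.keys p. \<exists>m \<in> monomials.
      has_HT (star f m) t \<and> has_HT (star (term_poly (HT f)) m) t \<and> geq t (HT f) \<and>
      HM (star f m) = scalar (Poly_Mapping.lookup p t) (term_poly t) \<and>
      q = p - star f m)"

definition right_red ::
  "(('t::wellorder \<Rightarrow>\<^sub>0 'k::field) \<Rightarrow> ('t \<Rightarrow>\<^sub>0 'k) \<Rightarrow> ('t \<Rightarrow>\<^sub>0 'k)) \<Rightarrow> ('t \<Rightarrow> 't \<Rightarrow> bool)
    \<Rightarrow> ('t \<Rightarrow>\<^sub>0 'k) set \<Rightarrow> ('t \<Rightarrow>\<^sub>0 'k) \<Rightarrow> ('t \<Rightarrow>\<^sub>0 'k) \<Rightarrow> bool"
  where
  "right_red star geq F p q \<longleftrightarrow> (\<exists>f\<in>F. right_red1 star geq f p q)"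

definition right_groebner_basis ::
  "(('t::wellorder \<Rightarrow>\<^sub>0 'k::field) \<Rightarrow> ('t \<Rightarrow>\<^sub>0 'k) \<Rightarrow> ('t \<Rightarrow>\<^sub>0 'k)) \<Rightarrow> ('t \<Rightarrow> 't \<Rightarrow> bool)
    \<Rightarrow> ('t \<Rightarrow>\<^sub>0 'k) set \<Rightarrow> bool"
  where
  "right_groebner_basis star geq F \<longleftrightarrow>
    (\<forall>f g. equivclp (right_red star geq F) f g \<longleftrightarrow> f - g \<in> right_ideal star F) \<and>
    confluentp (right_red star geq F)"

definition critical_tuples ::
  "(('t::wellorder \<Rightarrow>\<^sub>0 'k::field) \<Rightarrow> ('t \<Rightarrow>\<^sub>0 'k) \<Rightarrow> ('t \<Rightarrow>\<^sub>0 'k)) \<Rightarrow> ('t \<Rightarrow> 't \<Rightarrow> bool)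
    \<Rightarrow> ('t \<Rightarrow>\<^sub>0 'k) \<Rightarrow> ('t \<Rightarrow>\<^sub>0 'k) \<Rightarrow> ('t \<times> 't \<times> 't) set"
  where
  "critical_tuples star geq p q = {(t, u1, u2).
    has_HT (star p (term_poly u1)) t \<and> has_HT (star (term_poly (HT p)) (term_poly u1)) t \<and>
    has_HT (star q (term_poly u2)) t \<and> has_HT (star (term_poly (HT q)) (term_poly u2)) t \<and>
    geq t (HT p) \<and> geq t (HT q)}"

text \<open>The term \<open>t\<close> does not occur in the formula; it only indexes the polynomial.\<close>

definition right_spol ::
  "(('t::wellorder \<Rightarrow>\<^sub>0 'k::field) \<Rightarrow> ('t \<Rightarrow>\<^sub>0 'k) \<Rightarrow> ('t \<Rightarrow>\<^sub>0 'k))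
    \<Rightarrow> ('t \<Rightarrow>\<^sub>0 'k) \<Rightarrow> ('t \<Rightarrow>\<^sub>0 'k) \<Rightarrow> 't \<Rightarrow> 't \<Rightarrow> 't \<Rightarrow> ('t \<Rightarrow>\<^sub>0 'k)"
  where
  "right_spol star p q t u1 u2 =
    scalar (inverse (HC (star p (term_poly u1)))) (star p (term_poly u1)) -
    scalar (inverse (HC (star q (term_poly u2)))) (star q (term_poly u2))"

end

theory Submission
  imports Defs
begin

text \<open>
  Call a product \<open>f \<star> m\<close> with \<open>f \<in> F\<close> reductive at \<open>s\<close> if it may be used to reduce at the
  term \<open>s\<close>, and filter the span of the reductive products by head term. By condition (1) the
  whole ideal lies in this span. By condition (2) two products reductive at the same \<open>t\<close> are
  proportional modulo the part of the span below \<open>t\<close>, so a single reduction step at \<open>t\<close> moves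
  any element of the \<open>t\<close>-th part into the lower part. Hence every element of the ideal reduces
  to zero by well-founded induction on \<open>t\<close>. Since \<open>f - g\<close> reducing to zero makes \<open>f\<close> and \<open>g\<close>
  joinable, this yields both the congruence and confluence, without a termination argument.
\<close>

section \<open>Scalar multiplication, monomials and head terms\<close>

lemma scalar_add_right: "scalar c (f + g) = scalar c f + scalar c g"
  by (rule poly_mapping_eqI) (simp add: lookup_scalar lookup_add algebra_simps)

lemma scalar_diff_right: "scalar c (f - g) = scalar c f - scalar c g"
  by (rule poly_mapping_eqI) (simp add: lookup_scalar lookup_minus algebra_simps)

lemma scalar_diff_left: "scalar (c - d) f = scalar c f - scalar d f"
  by (rule poly_mapping_eqI) (simp add: lookup_scalar lookup_minus algebra_simps)

lemma scalar_add_left: "scalar (c + d) f = scalar c f + scalar d f"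
  by (rule poly_mapping_eqI) (simp add: lookup_scalar lookup_add algebra_simps)

lemma scalar_scalar: "scalar c (scalar d f) = scalar (c * d) f"
  by (rule poly_mapping_eqI) (simp add: lookup_scalar algebra_simps)

lemma scalar_zero_right: "scalar c 0 = 0"
  by (rule poly_mapping_eqI) (simp add: lookup_scalar)

lemma scalar_zero_left: "scalar 0 f = 0"
  by (rule poly_mapping_eqI) (simp add: lookup_scalar)

lemma scalar_one: "scalar 1 f = f"
  by (rule poly_mapping_eqI) (simp add: lookup_scalar)

lemma keys_scalar: "c \<noteq> 0 \<Longrightarrow> Poly_Mapping.keys (scalar c f) = Poly_Mapping.keys f"
  by (auto simp: in_keys_iff lookup_scalar)

lemma scalar_term_poly: "scalar c (term_poly u) = Poly_Mapping.single u c"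
  by (rule poly_mapping_eqI) (simp add: lookup_scalar lookup_single when_def)

lemma scalar_single_monomial: "c \<noteq> 0 \<Longrightarrow> scalar c m \<in> monomials \<longleftrightarrow> m \<in> monomials"
  by (simp add: monomials_def keys_scalar)

lemma single_in_monomials: "c \<noteq> 0 \<Longrightarrow> Poly_Mapping.single u c \<in> monomials"
  by (simp add: monomials_def)

lemma monomialE:
  assumes "m \<in> monomials"
  obtains c u where "c \<noteq> 0" "m = scalar c (term_poly u)"
proof -
  obtain u where u: "Poly_Mapping.keys m = {u}"
    using assms by (auto simp: monomials_def card_1_singleton_iff)
  have "m = scalar (Poly_Mapping.lookup m u) (term_poly u)"
    using u by (intro poly_mapping_eqI)
      (auto simp: lookup_scalar lookup_single when_def in_keys_iff set_eq_iff)
  moreover have "Poly_Mapping.lookup m u \<noteq> 0"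
    using u by (simp flip: in_keys_iff)
  ultimately show thesis using that by blast
qed

text \<open>A term in the support already makes \<open>f\<close> non-zero, so \<open>Max\<close>
  disappears and head-term claims become inclusions of supports, which survive non-zero
  scaling.\<close>

lemma has_HT_iff:
  "has_HT f t \<longleftrightarrow> t \<in> Poly_Mapping.keys f \<and> Poly_Mapping.keys f \<subseteq> {..t}"
proof
  assume "has_HT f t"
  then show "t \<in> Poly_Mapping.keys f \<and> Poly_Mapping.keys f \<subseteq> {..t}"
    by (metis HT_def Max_ge Max_in atMost_iff finite_keys has_HT_def keys_eq_empty subsetI)
next
  assume "t \<in> Poly_Mapping.keys f \<and> Poly_Mapping.keys f \<subseteq> {..t}"
  then show "has_HT f t"
    by (auto simp: has_HT_def HT_def intro!: Max_eqI)
qed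

lemma has_HT_scalar: "c \<noteq> 0 \<Longrightarrow> has_HT (scalar c f) t \<longleftrightarrow> has_HT f t"
  by (simp add: has_HT_iff keys_scalar)

lemma HM_eq_iff:
  assumes "has_HT f t"
  shows "HM f = scalar c (term_poly t) \<longleftrightarrow> Poly_Mapping.lookup f t = c"
  using assms
  by (auto simp: HM_def HC_def has_HT_def scalar_term_poly)
     (metis lookup_single_eq)

section \<open>Building elements of the right ideal\<close>

lemma right_ideal_zero: "0 \<in> right_ideal star F"
proof -
  have "(\<forall>i<(0::nat). undefined i \<in> F) \<and> 0 = (\<Sum>i<(0::nat). star (undefined i) (undefined i))"
    by simp
  then show ?thesis unfolding right_ideal_def by blast
qed

lemma right_ideal_add_product:
  assumes "h \<in> right_ideal star F" "p \<in> F"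
  shows "h + star p g \<in> right_ideal star F"
proof -
  obtain n :: nat and f k where n: "\<forall>i<n. f i \<in> F" "h = (\<Sum>i<n. star (f i) (k i))"
    using assms(1) by (auto simp: right_ideal_def)
  have "\<forall>i<Suc n. (f(n := p)) i \<in> F"
    using n(1) assms(2) by (simp add: less_Suc_eq)
  moreover have "h + star p g = (\<Sum>i<Suc n. star ((f(n := p)) i) ((k(n := g)) i))"
    using n(2) by simp
  ultimately show ?thesis unfolding right_ideal_def by blast
qed

section \<open>Reduction steps as subtraction of reductive products\<close>

locale right_reduction = function_ring star
  for star :: "('t::wellorder \<Rightarrow>\<^sub>0 'k::field) \<Rightarrow> ('t \<Rightarrow>\<^sub>0 'k) \<Rightarrow> ('t \<Rightarrow>\<^sub>0 'k)"  (infixl "\<star>" 70) +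
  fixes geq :: "'t \<Rightarrow> 't \<Rightarrow> bool"
    and F :: "('t \<Rightarrow>\<^sub>0 'k) set"
begin

abbreviation red :: "('t \<Rightarrow>\<^sub>0 'k) \<Rightarrow> ('t \<Rightarrow>\<^sub>0 'k) \<Rightarrow> bool"  (infix "\<rightarrow>" 50)
  where "red \<equiv> right_red star geq F"

abbreviation reds :: "('t \<Rightarrow>\<^sub>0 'k) \<Rightarrow> ('t \<Rightarrow>\<^sub>0 'k) \<Rightarrow> bool"  (infix "\<rightarrow>*" 50)
  where "reds \<equiv> red\<^sup>*\<^sup>*"

text \<open>These are the conditions of a reduction step that do not mention the polynomial being
  reduced, which makes them invariant under non-zero scaling of \<open>m\<close>.\<close>

definition reductive_at :: "('t \<Rightarrow>\<^sub>0 'k) \<Rightarrow> ('t \<Rightarrow>\<^sub>0 'k) \<Rightarrow> 't \<Rightarrow> bool" where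
  "reductive_at f m s \<longleftrightarrow> f \<noteq> 0 \<and> f \<in> F \<and> m \<in> monomials \<and> has_HT (f \<star> m) s \<and>
    has_HT (term_poly (HT f) \<star> m) s \<and> geq s (HT f)"

text \<open>The sets \<open>{..t}\<close>, \<open>{..<t}\<close> and \<open>UNIV\<close> for
  \<open>S\<close> give the filtration. Adding products suffices for a linear span, because a
  non-zero scalar is absorbed into the monomial.\<close>

inductive_set rspan :: "'t set \<Rightarrow> ('t \<Rightarrow>\<^sub>0 'k) set" for S where
  zero: "0 \<in> rspan S"
| add_product: "p \<in> rspan S \<Longrightarrow> reductive_at f m s \<Longrightarrow> s \<in> S \<Longrightarrow> p + f \<star> m \<in> rspan S"

lemma star_zero_right: "f \<star> 0 = 0"
  using star_distrib_left[of f 0 0] by simp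

lemma minus_star: "- (f \<star> g) = f \<star> scalar (-1) g"
  by (rule poly_mapping_eqI) (simp add: star_scalar lookup_scalar)

lemma reductive_at_scalar: "c \<noteq> 0 \<Longrightarrow> reductive_at f (scalar c m) s \<longleftrightarrow> reductive_at f m s"
  by (simp add: reductive_at_def scalar_single_monomial star_scalar has_HT_scalar)

lemma reductive_at_lookup_nonzero:
  "reductive_at f m s \<Longrightarrow> Poly_Mapping.lookup (f \<star> m) s \<noteq> 0"
  by (auto simp: reductive_at_def has_HT_iff in_keys_iff)

lemma reductive_at_keys: "reductive_at f m s \<Longrightarrow> Poly_Mapping.keys (f \<star> m) \<subseteq> {..s}"
  by (auto simp: reductive_at_def has_HT_iff)

text \<open>Given the head term, the condition on \<open>HM\<close> only compares coefficients at
  \<open>t\<close>. That \<open>t\<close> lies in the support of \<open>p\<close> follows, as the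
  product has a non-zero coefficient there.\<close>

lemma red_iff:
  "p \<rightarrow> q \<longleftrightarrow> (\<exists>f m t. reductive_at f m t \<and>
     Poly_Mapping.lookup (f \<star> m) t = Poly_Mapping.lookup p t \<and> q = p - f \<star> m)"
proof
  assume "p \<rightarrow> q"
  then show "\<exists>f m t. reductive_at f m t \<and>
     Poly_Mapping.lookup (f \<star> m) t = Poly_Mapping.lookup p t \<and> q = p - f \<star> m"
    unfolding right_red_def right_red1_def reductive_at_def by (metis HM_eq_iff)
next
  assume "\<exists>f m t. reductive_at f m t \<and>
     Poly_Mapping.lookup (f \<star> m) t = Poly_Mapping.lookup p t \<and> q = p - f \<star> m"
  then obtain f m t where *: "reductive_at f m t"
    "Poly_Mapping.lookup (f \<star> m) t = Poly_Mapping.lookup p t" "q = p - f \<star> m" by blast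
  then have "Poly_Mapping.lookup p t \<noteq> 0"
    using reductive_at_lookup_nonzero by metis
  then have "t \<in> Poly_Mapping.keys p" "p \<noteq> 0"
    by (auto simp: in_keys_iff)
  then show "p \<rightarrow> q"
    using * HM_eq_iff[of "f \<star> m" t]
    unfolding right_red_def right_red1_def reductive_at_def by blast
qed

lemma zero_reds_iff: "0 \<rightarrow>* q \<longleftrightarrow> q = 0"
proof
  assume "0 \<rightarrow>* q"
  then show "q = 0"
    by (cases rule: converse_rtranclpE) (auto simp: right_red_def right_red1_def)
qed auto

text \<open>For non-zero \<open>c\<close> this is one step with the monomial
  \<open>scalar c m\<close>. For \<open>c = 0\<close> it is no step at all, hence the reflexive
  closure.\<close>

lemma reds_eliminate:
  assumes "reductive_at f m t"
    and "Poly_Mapping.lookup p t = c * Poly_Mapping.lookup (f \<star> m) t"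
  shows "p \<rightarrow>* p - scalar c (f \<star> m)"
proof (cases "c = 0")
  case True
  then show ?thesis by (simp add: scalar_zero_left)
next
  case False
  then have "p \<rightarrow> p - f \<star> scalar c m"
    unfolding red_iff using assms
    by (intro exI[of _ f] exI[of _ "scalar c m"] exI[of _ t])
      (simp add: reductive_at_scalar star_scalar lookup_scalar)
  then show ?thesis by (auto simp: star_scalar)
qed

section \<open>Reducing a difference\<close>

text \<open>The same product is eliminated at \<open>t\<close> from both \<open>f\<close> and
  \<open>g\<close>. The multiples \<open>c\<close> and \<open>d\<close> are their coefficients at
  \<open>t\<close> divided by that of the product, so \<open>c - d = 1\<close> and the difference
  loses exactly one copy.\<close>

lemma red_diff:
  assumes "f - g \<rightarrow> h"
  obtains f' g' where "f \<rightarrow>* f'" "g \<rightarrow>* g'" "h = f' - g'"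
proof -
  obtain k m t where k: "reductive_at k m t"
    "Poly_Mapping.lookup (k \<star> m) t = Poly_Mapping.lookup (f - g) t" "h = f - g - k \<star> m"
    using assms unfolding red_iff by blast
  define a where "a = Poly_Mapping.lookup (k \<star> m) t"
  define c where "c = Poly_Mapping.lookup f t / a"
  define d where "d = Poly_Mapping.lookup g t / a"
  have a: "a \<noteq> 0"
    using reductive_at_lookup_nonzero[OF k(1)] by (simp add: a_def)
  have "c - d = 1"
    using a k(2) by (simp add: c_def d_def a_def lookup_minus flip: diff_divide_distrib)
  then have "scalar c (k \<star> m) - scalar d (k \<star> m) = k \<star> m"
    by (simp add: scalar_one flip: scalar_diff_left)
  then have "h = (f - scalar c (k \<star> m)) - (g - scalar d (k \<star> m))"
    unfolding k(3) by (simp add: algebra_simps)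
  moreover have "f \<rightarrow>* f - scalar c (k \<star> m)" "g \<rightarrow>* g - scalar d (k \<star> m)"
    using a by (auto intro!: reds_eliminate[OF k(1)] simp: c_def d_def simp flip: a_def)
  ultimately show thesis using that by blast
qed

lemma reds_diff:
  assumes "f - g \<rightarrow>* h"
  shows "\<exists>f' g'. f \<rightarrow>* f' \<and> g \<rightarrow>* g' \<and> h = f' - g'"
  using assms
proof (induction rule: rtranclp_induct)
  case (step y z)
  then show ?case by (metis red_diff rtranclp_trans)
qed auto

lemma reds_diff_zero_joinable:
  assumes "f - g \<rightarrow>* 0"
  obtains h where "f \<rightarrow>* h" "g \<rightarrow>* h"
  using reds_diff[OF assms] by auto

section \<open>The filtered span of reductive products\<close>

lemma rspan_add:
  assumes "p \<in> rspan S" "q \<in> rspan S"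
  shows "p + q \<in> rspan S"
  using assms(2)
  by induction (auto simp: assms(1) simp flip: add.assoc intro: add_product)

lemma rspan_scalar:
  assumes "p \<in> rspan S"
  shows "scalar c p \<in> rspan S"
proof (cases "c = 0")
  case False
  show ?thesis using assms
  proof induction
    case (add_product p f m s)
    then show ?case
      using rspan.add_product[of "scalar c p" S f "scalar c m" s] False
      by (simp add: reductive_at_scalar star_scalar scalar_add_right)
  qed (simp add: scalar_zero_right rspan.zero)
qed (simp add: scalar_zero_left rspan.zero)

lemma rspan_mono:
  assumes "p \<in> rspan S" "S \<subseteq> S'"
  shows "p \<in> rspan S'"
  using assms by induction (auto intro: rspan.intros)

lemma reductive_at_in_rspan: "reductive_at f m s \<Longrightarrow> s \<in> S \<Longrightarrow> f \<star> m \<in> rspan S"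
  using rspan.add_product[OF rspan.zero] by simp

lemma rspan_keys:
  assumes "p \<in> rspan S" "\<And>s t. s \<in> S \<Longrightarrow> t \<le> s \<Longrightarrow> t \<in> S"
  shows "Poly_Mapping.keys p \<subseteq> S"
  using assms(1)
proof induction
  case (add_product p f m s)
  have "Poly_Mapping.keys (f \<star> m) \<subseteq> S"
    using reductive_at_keys[OF add_product.hyps(2)] add_product.hyps(3) assms(2) by blast
  then show ?case
    using add_product.IH Poly_Mapping.keys_add[of p "f \<star> m"] by blast
qed simp

text \<open>Adding up the products subtracted on the way to zero recovers \<open>p\<close>. Each is
  reductive at a term of the current support, and downward closure of \<open>S\<close> keeps the
  next support inside \<open>S\<close>.\<close>

lemma reds_zero_in_rspan:
  assumes "p \<rightarrow>* 0" "Poly_Mapping.keys p \<subseteq> S" "\<And>s t. s \<in> S \<Longrightarrow> t \<le> s \<Longrightarrow> t \<in> S"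
  shows "p \<in> rspan S"
  using assms(1,2)
proof (induction rule: converse_rtranclp_induct)
  case (step p q)
  obtain f m t where f: "reductive_at f m t"
    "Poly_Mapping.lookup (f \<star> m) t = Poly_Mapping.lookup p t" "q = p - f \<star> m"
    using step.hyps(1) unfolding red_iff by blast
  have t: "t \<in> S"
    using f(1,2) reductive_at_lookup_nonzero step.prems by (metis in_keys_iff subsetD)
  then have "Poly_Mapping.keys (f \<star> m) \<subseteq> S"
    using reductive_at_keys[OF f(1)] assms(3) by blast
  then have "Poly_Mapping.keys q \<subseteq> S"
    using step.prems keys_diff[of p "f \<star> m"] unfolding f(3) by blast
  then show ?case
    using rspan.add_product[OF step.IH f(1) t] f(3) by simp
qed (rule rspan.zero)

text \<open>Only finitely many products are added, so their head terms have a maximum. Zero is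
  excluded because \<open>S\<close> may be empty.\<close>

lemma rspan_bounded:
  assumes "p \<in> rspan S" "p \<noteq> 0"
  obtains s where "s \<in> S" "p \<in> rspan {..s}"
proof -
  have "p = 0 \<or> (\<exists>s\<in>S. p \<in> rspan {..s})"
    using assms(1)
  proof induction
    case (add_product p f m s)
    then consider "p = 0" | s' where "s' \<in> S" "p \<in> rspan {..s'}" by blast
    then show ?case
    proof cases
      case 1
      then show ?thesis
        using add_product.hyps reductive_at_in_rspan[of f m s "{..s}"] by auto
    next
      case 2
      have "p \<in> rspan {..max s s'}"
        using 2(2) by (rule rspan_mono) simp
      then have "p + f \<star> m \<in> rspan {..max s s'}"
        using add_product.hyps(2) by (rule rspan.add_product) simp
      moreover have "max s s' \<in> S"
        using 2(1) add_product.hyps(3) by (simp add: max_def)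
      ultimately show ?thesis by blast
    qed
  qed simp
  then show thesis using assms(2) that by blast
qed

section \<open>The right ideal, conversion and the span\<close>

text \<open>The summand \<open>h\<close> lets the differences telescope along a conversion, whose
  steps run in either direction; the sign goes into the right factor.\<close>

lemma red_diff_in_right_ideal:
  assumes "p \<rightarrow> q" "h \<in> right_ideal star F"
  shows "h + (p - q) \<in> right_ideal star F" "h + (q - p) \<in> right_ideal star F"
proof -
  obtain f m t where f: "f \<in> F" "q = p - f \<star> m"
    using assms(1) unfolding red_iff reductive_at_def by blast
  then show "h + (p - q) \<in> right_ideal star F"
    using right_ideal_add_product[OF assms(2) f(1), of m] by simp
  have "q - p = f \<star> scalar (-1) m"
    using f(2) by (simp flip: minus_star)
  then show "h + (q - p) \<in> right_ideal star F"
    using right_ideal_add_product[OF assms(2) f(1)] by simp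
qed

lemma equivclp_imp_diff_in_right_ideal:
  assumes "equivclp red f g"
  shows "f - g \<in> right_ideal star F"
  using assms
proof (induction rule: equivclp_induct)
  case base
  show ?case by (simp add: right_ideal_zero)
next
  case (step y z)
  have "f - z = (f - y) + (y - z)" by simp
  then show ?case
    using step.hyps(2) red_diff_in_right_ideal[OF _ step.IH] by metis
qed

lemma spol_in_right_ideal:
  assumes "p \<in> F" "q \<in> F"
  shows "right_spol star p q t u v \<in> right_ideal star F"
proof -
  define a where "a = scalar (inverse (HC (p \<star> term_poly u))) (term_poly u)"
  define b where "b = scalar (inverse (HC (q \<star> term_poly v))) (term_poly v)"
  have "right_spol star p q t u v = 0 + p \<star> a + q \<star> scalar (-1) b"
    by (simp add: right_spol_def a_def b_def flip: star_scalar minus_star)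
  then show ?thesis
    using right_ideal_add_product right_ideal_zero assms by metis
qed

text \<open>Condition (1) enters here: a product \<open>f \<star> m\<close> need not be reductive
  itself, but its reduction to zero writes it as a sum of reductive ones. Distributivity extends
  this to arbitrary right factors.\<close>

lemma right_ideal_subset_rspan:
  assumes "\<And>f m. f \<in> F \<Longrightarrow> m \<in> monomials \<Longrightarrow> f \<star> m \<rightarrow>* 0"
    and "h \<in> right_ideal star F"
  shows "h \<in> rspan UNIV"
proof -
  have product: "f \<star> g \<in> rspan UNIV" if "f \<in> F" for f g
  proof (induction g rule: update_induct)
    case const
    show ?case by (simp add: star_zero_right rspan.zero)
  next
    case (update g u c)
    \<comment> \<open>As \<open>u\<close> is outside the support of \<open>g\<close>, the update is
      the addition of a monomial.\<close>
    have "Poly_Mapping.update u c g = g + Poly_Mapping.single u c"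
      using update.hyps(1)
      by (intro poly_mapping_eqI)
        (auto simp: lookup_update lookup_add lookup_single when_def in_keys_iff)
    moreover have "f \<star> Poly_Mapping.single u c \<in> rspan UNIV"
      using assms(1)[OF that single_in_monomials[OF update.hyps(2)]]
      by (intro reds_zero_in_rspan) auto
    ultimately show ?case
      using update.IH by (simp add: star_distrib_left rspan_add)
  qed
  obtain n :: nat and f k where n: "\<forall>i<n. f i \<in> F" "h = (\<Sum>i<n. f i \<star> k i)"
    using assms(2) by (auto simp: right_ideal_def)
  have "(\<Sum>i<j. f i \<star> k i) \<in> rspan UNIV" if "j \<le> n" for j
    using that
  proof (induction j)
    case (Suc j)
    then have "(\<Sum>i<j. f i \<star> k i) \<in> rspan UNIV" "f j \<in> F"
      using n(1) by auto
    then show ?case by (simp add: rspan_add product)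
  qed (simp add: rspan.zero)
  then show ?thesis using n(2) by blast
qed

section \<open>Condition (2) and reduction to zero\<close>

text \<open>Normalised to coefficient 1 at \<open>t\<close>, the two products differ by an
  s-polynomial. It cancels at \<open>t\<close> and reduces to zero, hence lies in the span below
  \<open>t\<close>.\<close>

lemma proportional_modulo_lower:
  assumes spol: "\<And>p q t u v. p \<in> F \<Longrightarrow> q \<in> F \<Longrightarrow> (t, u, v) \<in> critical_tuples star geq p q \<Longrightarrow>
      right_spol star p q t u v \<rightarrow>* 0"
    and f: "reductive_at f m t" and g: "reductive_at g n t"
  shows "\<exists>c. g \<star> n - scalar c (f \<star> m) \<in> rspan {..<t}"
proof -
  obtain a u where a: "a \<noteq> 0" "m = scalar a (term_poly u)"
    using f monomialE unfolding reductive_at_def by metis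
  obtain b v where b: "b \<noteq> 0" "n = scalar b (term_poly v)"
    using g monomialE unfolding reductive_at_def by metis
  have fu: "reductive_at f (term_poly u) t" and gv: "reductive_at g (term_poly v) t"
    using f g a b by (simp_all add: reductive_at_scalar)
  define x where "x = Poly_Mapping.lookup (f \<star> term_poly u) t"
  define y where "y = Poly_Mapping.lookup (g \<star> term_poly v) t"
  have xy: "x \<noteq> 0" "y \<noteq> 0"
    using fu gv by (simp_all add: x_def y_def reductive_at_lookup_nonzero)
  define s where "s = right_spol star g f t v u"
  have s: "s = scalar (inverse y) (g \<star> term_poly v) - scalar (inverse x) (f \<star> term_poly u)"
    using fu gv by (simp add: s_def right_spol_def HC_def x_def y_def reductive_at_def has_HT_def)
  have "(t, v, u) \<in> critical_tuples star geq g f"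
    using fu gv by (simp add: critical_tuples_def reductive_at_def)
  then have "s \<rightarrow>* 0"
    using spol fu gv by (simp add: s_def reductive_at_def)
  moreover have "Poly_Mapping.keys s \<subseteq> {..<t}"
  proof -
    have "Poly_Mapping.keys s \<subseteq> {..t}"
      using keys_diff reductive_at_keys[OF fu] reductive_at_keys[OF gv] xy
      unfolding s by (fastforce simp: keys_scalar)
    moreover have "Poly_Mapping.lookup s t = 0"
      using xy by (simp add: s lookup_minus lookup_scalar flip: x_def y_def)
    ultimately show ?thesis
      by (auto simp: in_keys_iff subset_iff order.strict_iff_order)
  qed
  ultimately have "s \<in> rspan {..<t}"
    by (rule reds_zero_in_rspan) auto
  \<comment> \<open>The factor \<open>b * y\<close> undoes the normalisation of the first summand
    and restores the coefficient of \<open>n\<close>.\<close>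
  then have "scalar (b * y) s \<in> rspan {..<t}"
    by (rule rspan_scalar)
  moreover have "scalar (b * y) s = g \<star> n - scalar (b * y / (x * a)) (f \<star> m)"
    using xy a(1) by (simp add: s a b star_scalar scalar_diff_right scalar_scalar field_simps)
  ultimately show ?thesis by auto
qed

lemma rspan_reds_zero:
  assumes spol: "\<And>p q t u v. p \<in> F \<Longrightarrow> q \<in> F \<Longrightarrow> (t, u, v) \<in> critical_tuples star geq p q \<Longrightarrow>
      right_spol star p q t u v \<rightarrow>* 0"
  shows "p \<in> rspan {..t} \<Longrightarrow> p \<rightarrow>* 0"
proof (induction t arbitrary: p rule: less_induct)
  case (less t)
  \<comment> \<open>If some product is reductive at \<open>t\<close>, a fixed one serves as
    reference for all summands of \<open>p\<close>; otherwise the parts up to \<open>t\<close> and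
    below \<open>t\<close> coincide.\<close>
  have "\<exists>r\<in>rspan {..<t}. p \<rightarrow>* r"
  proof (cases "\<exists>f m. reductive_at f m t")
    case True
    then obtain f m where f: "reductive_at f m t" by blast
    have "\<exists>c. p - scalar c (f \<star> m) \<in> rspan {..<t}"
      using less.prems
    proof induction
      case zero
      show ?case by (rule exI[of _ 0]) (simp add: scalar_zero_left rspan.zero)
    next
      case (add_product p g n s)
      obtain c where c: "p - scalar c (f \<star> m) \<in> rspan {..<t}"
        using add_product.IH by blast
      obtain d where d: "g \<star> n - scalar d (f \<star> m) \<in> rspan {..<t}"
      proof (cases "s = t")
        case True
        then show ?thesis
          using that proportional_modulo_lower[OF spol f] add_product.hyps(2) by blast
      next
        case False
        then have "g \<star> n \<in> rspan {..<t}"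
          using add_product.hyps(2,3) by (intro reductive_at_in_rspan) auto
        then show ?thesis using that[of 0] by (simp add: scalar_zero_left)
      qed
      have "p + g \<star> n - scalar (c + d) (f \<star> m) \<in> rspan {..<t}"
        using rspan_add[OF c d] by (simp add: scalar_add_left algebra_simps)
      then show ?case by blast
    qed
    then obtain c where c: "p - scalar c (f \<star> m) \<in> rspan {..<t}" by blast
    \<comment> \<open>Lying below \<open>t\<close>, the difference vanishes at \<open>t\<close>; so
      \<open>c\<close> is the very multiple that \<open>reds_eliminate\<close> can subtract.\<close>
    have "Poly_Mapping.keys (p - scalar c (f \<star> m)) \<subseteq> {..<t}"
      using c by (rule rspan_keys) auto
    then have "t \<notin> Poly_Mapping.keys (p - scalar c (f \<star> m))"
      by blast
    then have "Poly_Mapping.lookup p t = c * Poly_Mapping.lookup (f \<star> m) t"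
      by (simp add: in_keys_iff lookup_minus lookup_scalar)
    then show ?thesis
      using reds_eliminate[OF f] c by blast
  next
    case False
    have "p \<in> rspan {..<t}"
      using less.prems
    proof induction
      case (add_product p g n s)
      then show ?case
        using False by (intro rspan.add_product) (auto simp: order.strict_iff_order)
    qed (rule rspan.zero)
    then show ?thesis by blast
  qed
  then obtain r where r: "r \<in> rspan {..<t}" "p \<rightarrow>* r" by blast
  have "r \<rightarrow>* 0"
  \<comment> \<open>A non-zero \<open>r\<close> already lies in the span up to some
    \<open>s < t\<close>, where the induction hypothesis applies.\<close>
  proof (cases "r = 0")
    case False
    then show ?thesis
      using rspan_bounded[OF r(1)] less.IH by (metis lessThan_iff)
  qed simp
  then show ?case using r(2) by simp
qed

section \<open>The characterisation of right Groebner bases\<close>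

lemma groebner_basis_iff:
  "right_groebner_basis star geq F \<longleftrightarrow>
    (\<forall>f\<in>F. \<forall>m\<in>monomials. f \<star> m \<rightarrow>* 0) \<and>
    (\<forall>p\<in>F. \<forall>q\<in>F. \<forall>(t, u, v)\<in>critical_tuples star geq p q. right_spol star p q t u v \<rightarrow>* 0)"
  (is "?G \<longleftrightarrow> ?C")
proof
  assume G: ?G
  \<comment> \<open>An ideal element is congruent to zero, so by confluence it has a common reduct
    with zero, which is irreducible.\<close>
  have *: "h \<rightarrow>* 0" if "h \<in> right_ideal star F" for h
  proof -
    have "equivclp red h 0"
      using G that by (simp add: right_groebner_basis_def)
    moreover have "semiconfluentp red"
      using G by (simp add: right_groebner_basis_def confluentp_imp_semiconfluentp)
    ultimately have "(red\<^sup>*\<^sup>* OO red\<inverse>\<inverse>\<^sup>*\<^sup>*) h 0"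
      by (subst (asm) semiconfluentp_equivclp)
    then obtain k where "h \<rightarrow>* k" "0 \<rightarrow>* k"
      unfolding rtranclp_conversep by blast
    then show ?thesis by (simp add: zero_reds_iff)
  qed
  show ?C
    using right_ideal_add_product[OF right_ideal_zero, of _ F star]
    by (auto intro!: * spol_in_right_ideal)
next
  assume C: ?C
  have *: "h \<rightarrow>* 0" if "h \<in> right_ideal star F" for h
  proof (cases "h = 0")
    case False
    have "h \<in> rspan UNIV"
      using C that by (intro right_ideal_subset_rspan) auto
    then obtain t where t: "h \<in> rspan {..t}"
      using rspan_bounded False by blast
    show ?thesis
      by (rule rspan_reds_zero[OF _ t]) (use C in fast)
  qed simp
  have equiv: "equivclp red f g" if "f \<rightarrow>* h" "g \<rightarrow>* h" for f g h
    using that by (meson equivclp_sym equivclp_trans rtranclp_into_equivclp)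
  show ?G
    unfolding right_groebner_basis_def
  proof (intro conjI allI iffI)
    fix f g
    assume "f - g \<in> right_ideal star F"
    then show "equivclp red f g"
      using * reds_diff_zero_joinable equiv by metis
  next
    show "confluentp red"
    proof (rule confluentpI)
      fix p q q'
      assume "p \<rightarrow>* q" "p \<rightarrow>* q'"
      \<comment> \<open>Both reducts are convertible through \<open>p\<close>, so their difference
        is in the ideal and reduces to zero.\<close>
      then have "equivclp red q q'"
        by (meson equivclp_sym equivclp_trans rtranclp_into_equivclp)
      then have "q - q' \<rightarrow>* 0"
        by (intro * equivclp_imp_diff_in_right_ideal)
      then show "\<exists>r. q \<rightarrow>* r \<and> q' \<rightarrow>* r"
        using reds_diff_zero_joinable by metis
    qed
  qed (rule equivclp_imp_diff_in_right_ideal)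
qed

end

theorem theorem4p2p33:
  fixes star :: "('t::wellorder \<Rightarrow>\<^sub>0 'k::field) \<Rightarrow> ('t \<Rightarrow>\<^sub>0 'k) \<Rightarrow> ('t \<Rightarrow>\<^sub>0 'k)"
    and geq :: "'t \<Rightarrow> 't \<Rightarrow> bool"
    and F :: "('t \<Rightarrow>\<^sub>0 'k) set"
  assumes "function_ring star"
    and "right_reductive_restriction star geq"
    and "0 \<notin> F"
  shows "right_groebner_basis star geq F \<longleftrightarrow>
    (\<forall>f\<in>F. \<forall>m\<in>monomials. (right_red star geq F)\<^sup>*\<^sup>* (star f m) 0) \<and>
    (\<forall>p\<in>F. \<forall>q\<in>F. \<forall>(t, u1, u2)\<in>critical_tuples star geq p q.
      (right_red star geq F)\<^sup>*\<^sup>* (right_spol star p q t u1 u2) 0)"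
proof -
  interpret right_reduction star geq F
    using assms(1) by (simp add: right_reduction_def)
  show ?thesis by (rule groebner_basis_iff)
qed

end
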